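(* Let $\mathcal{P}$ be a finite poset. Then the function $\operatorname{Tr}(\mathcal{P})\to\operatorname{WFS}(\mathcal{P})$ given by $R\mapsto({}^{\square}R,R)$ is an isomorphism of posets.
   Context: Transfer system: for a finite poset $(\mathcal{P},\leq)$, a transfer system on $\mathcal{P}$ is a reflexive and transitive relation $R$ on $\mathcal{P}$ such that (1) $x\,R\,y$ implies $x\leq y$; and (2) for all $x,y,z\in\mathcal{P}$, if $x\,R\,z$ and $y\leq z$, then $m\,R\,y$ for every maximal element $m$ of $\{p\in \mathcal{P} : p\leq x \text{ and } p\leq y\}$. $\operatorname{Tr}(\mathcal{P})$ is the set of transfer systems on $\mathcal{P}$, partially ordered by inclusion of relations. Write $x\to y$ for the pair $(x,y)$ when $x\leq y$ (a morphism of $\mathcal{P}$ viewed as a category), and $x\to y\in R$ when $x\,R\,y$. Say that $x\to y$ has the right lifting property with respect to $a\to b$ (equivalently, $a\to b$ has the left lifting property with respect to $x\to y$) if [$a\leq x$ and $b\leq y$] implies $b\leq x$. For a relation $R$ refining $\leq$ (i.e. a set of pairs $x\to y$), $R^{\square}$ is the set of all $x\to y$ having the right lifting property with respect to all $a\to b\in R$, and ${}^{\square}R$ is the set of all $a\to b$ having the left lifting property with respect to all $x\to y\in R$. A weak factorization system on $\mathcal{P}$ is a pair $(L,R)$ of sets of pairs $x\to y$ such that (i) for every $x\leq y$ in $\mathcal{P}$ there is $w$ with $x\to w\in L$ and $w\to y\in R$; and (ii) $R=L^{\square}$ and $L={}^{\square}R$. $\operatorname{WFS}(\mathcal{P})$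 is the set of weak factorization systems on $\mathcal{P}$, partially ordered by $(L,R)\leq(L',R')$ if and only if $R\subseteq R'$. *)

theory Defs
  imports Main
begin

text \<open>
  A poset is given by a carrier \<open>P\<close> and an order relation \<open>le\<close> with \<open>partial_order_on P le\<close>
  (which includes \<open>le \<subseteq> P \<times> P\<close>), so that the empty poset is covered. The pair \<open>(x, y) \<in> le\<close>
  is the morphism from \<open>x\<close> to \<open>y\<close>.
\<close>

definition maximal_in :: "'a rel \<Rightarrow> 'a set \<Rightarrow> 'a \<Rightarrow> bool" where
  "maximal_in le S m \<longleftrightarrow> m \<in> S \<and> (\<forall>p\<in>S. (m, p) \<in> le \<longrightarrow> p = m)"

definition transfer_system :: "'a set \<Rightarrow> 'a rel \<Rightarrow> 'a rel \<Rightarrow> bool" where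
  "transfer_system P le R \<longleftrightarrow>
     R \<subseteq> le \<and> refl_on P R \<and> trans R \<and>
     (\<forall>x\<in>P. \<forall>y\<in>P. \<forall>z\<in>P. (x, z) \<in> R \<and> (y, z) \<in> le \<longrightarrow>
        (\<forall>m. maximal_in le {p \<in> P. (p, x) \<in> le \<and> (p, y) \<in> le} m \<longrightarrow> (m, y) \<in> R))"

definition Tr :: "'a set \<Rightarrow> 'a rel \<Rightarrow> 'a rel set" where
  "Tr P le = {R. transfer_system P le R}"

definition Tr_le :: "'a set \<Rightarrow> 'a rel \<Rightarrow> 'a rel rel" where
  "Tr_le P le = {(R, R'). R \<in> Tr P le \<and> R' \<in> Tr P le \<and> R \<subseteq> R'}"

text \<open>\<open>lifts le f g\<close>: the morphism \<open>f\<close> has the left lifting property with respect to \<open>g\<close>.\<close>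

definition lifts :: "'a rel \<Rightarrow> 'a \<times> 'a \<Rightarrow> 'a \<times> 'a \<Rightarrow> bool" where
  "lifts le = (\<lambda>(a, b) (x, y). (a, x) \<in> le \<and> (b, y) \<in> le \<longrightarrow> (b, x) \<in> le)"

definition rlp :: "'a rel \<Rightarrow> 'a rel \<Rightarrow> 'a rel" where
  "rlp le L = {g \<in> le. \<forall>f\<in>L. lifts le f g}"

definition llp :: "'a rel \<Rightarrow> 'a rel \<Rightarrow> 'a rel" where
  "llp le R = {f \<in> le. \<forall>g\<in>R. lifts le f g}"

definition weak_factorization_system :: "'a set \<Rightarrow> 'a rel \<Rightarrow> 'a rel \<times> 'a rel \<Rightarrow> bool" where
  "weak_factorization_system P le = (\<lambda>(L, R).
     L \<subseteq> le \<and> R \<subseteq> le \<and>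
     (\<forall>x\<in>P. \<forall>y\<in>P. (x, y) \<in> le \<longrightarrow> (\<exists>w\<in>P. (x, w) \<in> L \<and> (w, y) \<in> R)) \<and>
     R = rlp le L \<and> L = llp le R)"

definition WFS :: "'a set \<Rightarrow> 'a rel \<Rightarrow> ('a rel \<times> 'a rel) set" where
  "WFS P le = {W. weak_factorization_system P le W}"

definition WFS_le :: "'a set \<Rightarrow> 'a rel \<Rightarrow> ('a rel \<times> 'a rel) rel" where
  "WFS_le P le = {(W, W'). W \<in> WFS P le \<and> W' \<in> WFS P le \<and> snd W \<subseteq> snd W'}"

definition poset_iso :: "'a set \<Rightarrow> 'a rel \<Rightarrow> 'b set \<Rightarrow> 'b rel \<Rightarrow> ('a \<Rightarrow> 'b) \<Rightarrow> bool" where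
  "poset_iso A r B s f \<longleftrightarrow>
     partial_order_on A r \<and> partial_order_on B s \<and> bij_betw f A B \<and>
     (\<forall>x\<in>A. \<forall>y\<in>A. (x, y) \<in> r \<longleftrightarrow> (f x, f y) \<in> s)"

end

theory Submission
  imports Defs
begin

text \<open>
  Let \<open>R\<close> be a transfer system and \<open>x \<le> y\<close>. Among the \<open>w\<close> with \<open>x \<le> w\<close> and \<open>w R y\<close> choose a
  minimal one. If \<open>a R b\<close>, \<open>x \<le> a\<close> and \<open>w \<le> b\<close>, take a maximal common lower bound \<open>m \<ge> x\<close> of \<open>a\<close>
  and \<open>w\<close>: then \<open>m R w R y\<close>, so \<open>m = w\<close> by minimality and \<open>w \<le> a\<close>. Hence \<open>x \<rightarrow> w\<close> lifts against \<open>R\<close>,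
  and the retract argument gives that \<open>R\<close> is the right class of its left class. Conversely, if \<open>R\<close>
  is a right class, \<open>x R z\<close>, \<open>y \<le> z\<close> and \<open>m\<close> is a maximal common lower bound of \<open>x\<close> and \<open>y\<close>,
  factor \<open>m \<rightarrow> y\<close> through \<open>w\<close>; lifting \<open>m \<rightarrow> w\<close> against \<open>x \<rightarrow> z\<close> gives \<open>w \<le> x\<close>, so \<open>w = m\<close>.
\<close>

lemma finite_maximal_above:
  assumes "finite S" "S \<subseteq> P" "partial_order_on P le" "x \<in> S"
  obtains m where "maximal_in le S m" "(x, m) \<in> le"
proof -
  have po: "refl_on P le" "trans le" "antisym le"
    using assms(3) by (auto simp: partial_order_on_def preorder_on_def)
  let ?A = "{p \<in> S. (x, p) \<in> le}"
  have "finite ?A" "?A \<noteq> {}"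
    using assms po(1) by (auto dest: refl_onD)
  moreover have "asymp_on ?A (\<lambda>a b. (a, b) \<in> le \<and> a \<noteq> b)"
    by (rule asymp_onI) (metis po(3) antisymD)
  moreover have "transp_on ?A (\<lambda>a b. (a, b) \<in> le \<and> a \<noteq> b)"
    by (rule transp_onI) (metis po(2,3) antisymD transD)
  ultimately obtain m where m: "m \<in> ?A" "\<forall>p\<in>?A. p \<noteq> m \<longrightarrow> \<not> ((m, p) \<in> le \<and> m \<noteq> p)"
    using Finite_Set.bex_max_element[of ?A "\<lambda>a b. (a, b) \<in> le \<and> a \<noteq> b"] by blast
  \<comment> \<open>An element of \<open>S\<close> above \<open>m\<close> is also above
    \<open>x\<close>, hence in \<open>?A\<close>, so maximality passes from \<open>?A\<close> to
    \<open>S\<close>.\<close>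
  have "maximal_in le S m"
    using m po(2) unfolding maximal_in_def by (blast dest: transD)
  with m show thesis by (auto intro: that)
qed

text \<open>Minimality is encoded as maximality for the converse order, so the previous lemma
  applies to the dual poset.\<close>

lemma finite_minimal_exists:
  assumes "finite S" "S \<subseteq> P" "partial_order_on P le" "S \<noteq> {}"
  obtains m where "maximal_in (le\<inverse>) S m"
proof -
  have "partial_order_on P (le\<inverse>)"
    using assms(3) by simp
  with assms show thesis
    by (metis ex_in_conv finite_maximal_above that)
qed

text \<open>Serves twice: as the factorization axiom itself and as the input of the retract
  argument.\<close>

lemma transfer_system_factorization:
  assumes fin: "finite P" and po: "partial_order_on P le" and R: "transfer_system P le R"
    and xy: "(x, y) \<in> le"
  obtains w where "w \<in> P" "(x, w) \<in> llp le R" "(w, y) \<in> R"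
proof -
  have le: "refl_on P le" "trans le" "antisym le" "le \<subseteq> P \<times> P"
    using po by (auto simp: partial_order_on_def preorder_on_def)
  have Rle: "R \<subseteq> le" "refl_on P R" "trans R"
    and restr: "\<And>x y z m. x \<in> P \<Longrightarrow> y \<in> P \<Longrightarrow> z \<in> P \<Longrightarrow> (x, z) \<in> R \<Longrightarrow> (y, z) \<in> le
        \<Longrightarrow> maximal_in le {p \<in> P. (p, x) \<in> le \<and> (p, y) \<in> le} m \<Longrightarrow> (m, y) \<in> R"
    using R unfolding transfer_system_def by blast+
  have P: "x \<in> P" "y \<in> P" using xy le(4) by auto
  let ?S = "{w \<in> P. (x, w) \<in> le \<and> (w, y) \<in> R}"
  have "y \<in> ?S" using P xy Rle(2) by (auto dest: refl_onD)
  then obtain w where "maximal_in (le\<inverse>) ?S w"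
    using finite_minimal_exists[of ?S P le] fin po by auto
  then have w: "w \<in> P" "(x, w) \<in> le" "(w, y) \<in> R"
    and minw: "\<And>p. p \<in> ?S \<Longrightarrow> (p, w) \<in> le \<Longrightarrow> p = w"
    by (auto simp: maximal_in_def)
  have "(w, a) \<in> le" if ab: "(a, b) \<in> R" "(x, a) \<in> le" "(w, b) \<in> le" for a b
  proof -
    let ?B = "{p \<in> P. (p, a) \<in> le \<and> (p, w) \<in> le}"
    have abP: "a \<in> P" "b \<in> P" using ab Rle(1) le(4) by auto
    have "x \<in> ?B" using P ab w by auto
    then obtain m where m: "maximal_in le ?B m" "(x, m) \<in> le"
      using finite_maximal_above[of ?B P le x] fin po by auto
    have mB: "m \<in> P" "(m, a) \<in> le" "(m, w) \<in> le"
      using m(1) by (auto simp: maximal_in_def)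
    \<comment> \<open>Restrict \<open>(a, b)\<close> along \<open>(w, b)\<close>; composing with
      \<open>(w, y)\<close> then puts \<open>m\<close> into \<open>?S\<close>.\<close>
    have "(m, w) \<in> R"
      using restr[OF abP(1) w(1) abP(2) ab(1,3) m(1)] .
    then have "(m, y) \<in> R" using w(3) Rle(3) by (blast dest: transD)
    then have "m = w" using minw m(2) mB by blast
    with mB show ?thesis by simp
  qed
  then have "(x, w) \<in> llp le R"
    using w(2) by (auto simp: llp_def lifts_def)
  with w that show thesis by blast
qed

lemma transfer_system_imp_wfs:
  assumes fin: "finite P" and po: "partial_order_on P le" and R: "transfer_system P le R"
  shows "weak_factorization_system P le (llp le R, R)"
proof -
  have le: "refl_on P le" "antisym le" "le \<subseteq> P \<times> P"
    using po by (auto simp: partial_order_on_def preorder_on_def)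
  have Rle: "R \<subseteq> le" using R by (simp add: transfer_system_def)
  have "R \<subseteq> rlp le (llp le R)" using Rle by (auto simp: rlp_def llp_def)
  moreover have "rlp le (llp le R) \<subseteq> R"
  proof (rule subrelI)
    fix x y assume xy: "(x, y) \<in> rlp le (llp le R)"
    then have "(x, y) \<in> le" by (simp add: rlp_def)
    then obtain w where w: "(x, w) \<in> llp le R" "(w, y) \<in> R"
      using transfer_system_factorization[OF fin po R] by blast
    have "x \<in> P" using \<open>(x, y) \<in> le\<close> le(3) by auto
    \<comment> \<open>Lift \<open>(x, w)\<close> against \<open>(x, y)\<close> in the square with
      sides \<open>(x, x)\<close> and \<open>(w, y)\<close>.\<close>
    then have "(w, x) \<in> le"
      using xy w Rle le(1) by (fastforce simp: rlp_def lifts_def dest: refl_onD)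
    moreover have "(x, w) \<in> le" using w(1) by (simp add: llp_def)
    ultimately have "w = x" using le(2) by (blast dest: antisymD)
    with w show "(x, y) \<in> R" by simp
  qed
  moreover have "\<exists>w\<in>P. (x, w) \<in> llp le R \<and> (w, y) \<in> R" if "(x, y) \<in> le" for x y
    using transfer_system_factorization[OF fin po R that] by blast
  ultimately show ?thesis
    using Rle by (auto simp: weak_factorization_system_def llp_def)
qed

lemma wfs_imp_transfer_system:
  assumes po: "partial_order_on P le" and W: "weak_factorization_system P le (L, R)"
  shows "transfer_system P le R"
proof -
  have le: "refl_on P le" "trans le" "antisym le" "le \<subseteq> P \<times> P"
    using po by (auto simp: partial_order_on_def preorder_on_def)
  have fact: "\<And>x y. (x, y) \<in> le \<Longrightarrow> \<exists>w\<in>P. (x, w) \<in> L \<and> (w, y) \<in> R"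
    and Rrlp: "R = rlp le L" and sub: "L \<subseteq> le" "R \<subseteq> le"
    using W le(4) unfolding weak_factorization_system_def by blast+
  have lift: "(b, x) \<in> le" if "(a, b) \<in> L" "(x, y) \<in> R" "(a, x) \<in> le" "(b, y) \<in> le" for a b x y
    using that unfolding Rrlp by (auto simp: rlp_def lifts_def)
  have "refl_on P R"
    using le(1) unfolding Rrlp by (auto simp: rlp_def lifts_def refl_on_def)
  moreover have "trans R"
  proof (rule transI)
    fix x y z assume xyz: "(x, y) \<in> R" "(y, z) \<in> R"
    then have "(x, y) \<in> le" "(x, z) \<in> le" using sub le(2) by (blast dest: transD)+
    moreover have "(b, x) \<in> le" if "(a, b) \<in> L" "(a, x) \<in> le" "(b, z) \<in> le" for a b
    proof -
      \<comment> \<open>Two successive lifts: against \<open>(y, z)\<close> to get \<open>b\<close>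
        below \<open>y\<close>, then against \<open>(x, y)\<close>.\<close>
      have "(a, y) \<in> le" using that \<open>(x, y) \<in> le\<close> le(2) by (blast dest: transD)
      then show ?thesis using lift xyz that by blast
    qed
    ultimately show "(x, z) \<in> R" unfolding Rrlp by (auto simp: rlp_def lifts_def)
  qed
  moreover have "(m, y) \<in> R"
    if "(x, z) \<in> R" "(y, z) \<in> le"
      and m: "maximal_in le {p \<in> P. (p, x) \<in> le \<and> (p, y) \<in> le} m" for x y z m
  proof -
    have mxy: "(m, x) \<in> le" "(m, y) \<in> le" using m by (auto simp: maximal_in_def)
    obtain w where w: "w \<in> P" "(m, w) \<in> L" "(w, y) \<in> R" using fact[OF mxy(2)] by blast
    have "(w, z) \<in> le" using w(3) sub(2) that(2) le(2) by (blast dest: transD)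
    then have "(w, x) \<in> le" using lift[OF w(2) that(1) mxy(1)] by blast
    \<comment> \<open>Now \<open>w\<close> is a common lower bound of \<open>x\<close> and
      \<open>y\<close> above the maximal one \<open>m\<close>.\<close>
    then have "w = m" using m w sub by (auto simp: maximal_in_def)
    with w show ?thesis by simp
  qed
  ultimately show ?thesis
    using sub(2) unfolding transfer_system_def by blast
qed

lemma partial_order_on_Tr_le: "partial_order_on (Tr P le) (Tr_le P le)"
  by (auto simp: partial_order_on_def preorder_on_def Tr_le_def
      intro!: refl_onI transI antisymI)

text \<open>The order compares right classes only; antisymmetry holds because the right class
  determines the left one.\<close>

lemma partial_order_on_WFS_le: "partial_order_on (WFS P le) (WFS_le P le)"
proof -
  have "L = llp le R" if "(L, R) \<in> WFS P le" for L R
    using that unfolding WFS_def weak_factorization_system_def by blast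
  then have "W = W'" if "W \<in> WFS P le" "W' \<in> WFS P le" "snd W = snd W'" for W W'
    using that by (metis prod.collapse)
  then have "antisym (WFS_le P le)"
    unfolding WFS_le_def by (auto intro!: antisymI)
  moreover have "trans (WFS_le P le)"
    unfolding WFS_le_def by (auto intro!: transI)
  ultimately show ?thesis
    by (auto simp: partial_order_on_def preorder_on_def WFS_le_def intro!: refl_onI)
qed

theorem theorem6p9:
  fixes P :: "'a set" and le :: "'a rel"
  assumes "finite P" and "partial_order_on P le"
  shows "poset_iso (Tr P le) (Tr_le P le) (WFS P le) (WFS_le P le) (\<lambda>R. (llp le R, R))"
proof -
  have to_WFS: "(llp le R, R) \<in> WFS P le" if "R \<in> Tr P le" for R
    using transfer_system_imp_wfs[OF assms] that by (simp add: Tr_def WFS_def)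
  have "W \<in> (\<lambda>R. (llp le R, R)) ` Tr P le" if "W \<in> WFS P le" for W
  proof -
    obtain L R where [simp]: "W = (L, R)" by (cases W)
    have "weak_factorization_system P le (L, R)" using that by (simp add: WFS_def)
    then have "R \<in> Tr P le" "L = llp le R"
      using wfs_imp_transfer_system[OF assms(2)]
      unfolding Tr_def weak_factorization_system_def by blast+
    then show ?thesis by auto
  qed
  \<comment> \<open>Injectivity is immediate, since \<open>R\<close> is the second component of its
    image.\<close>
  with to_WFS have "bij_betw (\<lambda>R. (llp le R, R)) (Tr P le) (WFS P le)"
    by (auto simp: bij_betw_def inj_on_def)
  then show ?thesis
    using to_WFS partial_order_on_Tr_le[of P le] partial_order_on_WFS_le[of P le]
    unfolding poset_iso_def by (simp add: Tr_le_def WFS_le_def)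
qed

end
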